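(* Let $\mathcal{C}_2$ be the two-dimensional comb, let $h(x)=\left\lfloor (x+1)^2/3\right\rfloor$ for $x\in\mathbb{N}_0$, and for integers $m\ge0$ let $$B_m=\{(x,y)\in\mathcal{C}_2:\ |x|\le m,\ |y|\le h(m-|x|)\}.$$ There exist a function $e:\mathbb{N}_0\to(0,\infty)$ and a constant $c$ with $0<c<\frac12$ such that $\lim_{x\to\infty}\frac{e(x)}{x}=c$, and such that for all $m\ge0$ the harmonic measure $\nu_{m,o}(z)$, $z=(z_x,z_y)\in\partial B_m$, is proportional to $e(m-|z_x|)$; that is, for every $m\ge 0$ there is a constant $C_m>0$ with $\nu_{m,o}(z)=C_m\, e(m-|z_x|)$ for all $z=(z_x,z_y)\in\partial B_m$.
   Context: $\mathbb{N}_0=\{0,1,2,\dots\}$. The two-dimensional comb $\mathcal{C}_2$ is the graph with vertex set $\mathbb{Z}^2$ obtained from the square lattice $\mathbb{Z}^2$ by removing all horizontal edges except those on the $x$-axis. Thus $(x,y)\sim(x,y\pm1)$ for all $(x,y)$, and $(x,0)\sim(x\pm1,0)$. The root is $o=(0,0)$. The inner boundary of $B_m$ is $\partial B_m=\{z\in B_m:\ z\text{ has a neighbour } y \text{ in } \mathcal{C}_2 \text{ with } y\notin B_m\}$. Simple random walk on $\mathcal{C}_2$ moves at each step to a uniformly chosen neighbour of the current vertex. For $z\in\partial B_m$, $\nu_{m,o}(z)$ denotes the probability that the simple random walk $(X_t)_{t\ge0}$ started at $o$ first hits $\partial B_m$ at $z$, i.e. $\nu_{m,o}(z)=\mathbb{P}_o[X_T=z]$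 with $T=\inf\{t\ge0: X_t\in\partial B_m\}$. The measure $\nu_{m,o}$ on $\partial B_m$ is called the harmonic measure of $B_m$. *)

theory Defs
  imports "HOL-Probability.Probability"
begin

section \<open>Simple random walk and harmonic measure\<close>

text \<open>Graphs are given by their adjacency relation on the type of vertices.\<close>

definition inner_boundary :: "('v \<Rightarrow> 'v \<Rightarrow> bool) \<Rightarrow> 'v set \<Rightarrow> 'v set" where
  "inner_boundary E B = {z \<in> B. \<exists>y. E z y \<and> y \<notin> B}"

text \<open>The conditional law of the position at time \<open>n\<close>, given the positions at times \<open>0, \<dots>, n - 1\<close>.
  It is the intended one only if every vertex has finitely many and at least one neighbour.\<close>

definition srw_kernel :: "('v \<Rightarrow> 'v \<Rightarrow> bool) \<Rightarrow> 'v \<Rightarrow> nat \<Rightarrow> (nat \<Rightarrow> 'v) \<Rightarrow> 'v measure" where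
  "srw_kernel E v n \<omega> = measure_pmf
     (case n of 0 \<Rightarrow> return_pmf v | Suc k \<Rightarrow> pmf_of_set {w. E (\<omega> k) w})"

text \<open>The law of the walk started at \<open>v\<close> on the space of all trajectories, by the
  Ionescu-Tulcea extension theorem.\<close>

definition srw :: "('v \<Rightarrow> 'v \<Rightarrow> bool) \<Rightarrow> 'v \<Rightarrow> (nat \<Rightarrow> 'v) measure" where
  "srw E v = projective_family.lim UNIV
     (Ionescu_Tulcea.CI (srw_kernel E v) (\<lambda>_. count_space UNIV)) (\<lambda>_. count_space UNIV)"

definition hitting_time :: "'v set \<Rightarrow> (nat \<Rightarrow> 'v) \<Rightarrow> enat" where
  "hitting_time A \<omega> = Inf {enat t |t. \<omega> t \<in> A}"

definition harmonic_measure :: "('v \<Rightarrow> 'v \<Rightarrow> bool) \<Rightarrow> 'v set \<Rightarrow> 'v \<Rightarrow> 'v \<Rightarrow> real" where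
  "harmonic_measure E B v z =
     measure (srw E v) {\<omega>. \<exists>t. hitting_time (inner_boundary E B) \<omega> = enat t \<and> \<omega> t = z}"

lemma Ionescu_Tulcea_srw: "Ionescu_Tulcea (srw_kernel E v) (\<lambda>_. count_space UNIV)"
proof (rule Ionescu_Tulcea.intro)
  fix i
  show "srw_kernel E v i \<in> measurable (PiM {0..<i} (\<lambda>_. count_space UNIV))
      (subprob_algebra (count_space UNIV))"
  proof (cases i)
    case 0
    then show ?thesis
      by (simp add: srw_kernel_def[abs_def] space_subprob_algebra
          measure_pmf.subprob_space_axioms)
  next
    case (Suc k)
    have "(\<lambda>x. measure_pmf (pmf_of_set {w. E x w}))
        \<in> measurable (count_space UNIV) (subprob_algebra (count_space UNIV))"
      by (simp add: space_subprob_algebra measure_pmf.subprob_space_axioms)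
    moreover have "(\<lambda>\<omega>. \<omega> k) \<in> measurable (PiM {0..<i} (\<lambda>_. count_space UNIV)) (count_space UNIV)"
      using Suc by (intro measurable_component_singleton) auto
    ultimately show ?thesis
      using measurable_compose unfolding srw_kernel_def[abs_def] Suc by fastforce
  qed
next
  fix i \<omega>
  show "prob_space (srw_kernel E v i \<omega>)"
    by (simp add: srw_kernel_def measure_pmf.prob_space_axioms)
qed

lemma sets_srw: "sets (srw E v) = sets (PiM UNIV (\<lambda>_. count_space UNIV))"
  and space_srw [simp]: "space (srw E v) = UNIV"
  and prob_space_srw: "prob_space (srw E v)"
proof -
  interpret IT: Ionescu_Tulcea "srw_kernel E v" "\<lambda>_. count_space UNIV"
    by (rule Ionescu_Tulcea_srw)
  show *: "sets (srw E v) = sets (PiM UNIV (\<lambda>_. count_space UNIV))"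
    by (simp add: srw_def)
  show "space (srw E v) = UNIV"
    using sets_eq_imp_space_eq[OF *] by (simp add: space_PiM)
  have "prob_space (distr (srw E v) (PiM {} (\<lambda>_. count_space UNIV)) (\<lambda>x. restrict x {}))"
    unfolding srw_def using IT.PF.prob_space_P[of "{}"] by (subst IT.distr_lim) simp_all
  moreover have "(\<lambda>x. restrict x {}) \<in>
      measurable (srw E v) (PiM {} (\<lambda>_. count_space UNIV))"
    unfolding measurable_cong_sets[OF * refl] by (intro measurable_restrict) auto
  ultimately show "prob_space (srw E v)"
    using prob_space_distrD by blast
qed

lemma emeasure_srw_cylinder:
  "emeasure (srw E v) {\<omega>. \<forall>i\<le>n. \<omega> i = p i} =
    indicator {v} (p 0) * (\<Prod>i<n. ennreal (pmf (pmf_of_set {w. E (p i) w}) (p (Suc i))))"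
proof -
  interpret IT: Ionescu_Tulcea "srw_kernel E v" "\<lambda>_. count_space UNIV"
    by (rule Ionescu_Tulcea_srw)
  let ?M = "\<lambda>_::nat. count_space (UNIV :: 'a set)"
  define A where "A n = PiE {0..<n} (\<lambda>i. {p i})" for n
  have A [measurable]: "A n \<in> sets (PiM {0..<n} ?M)" for n
    unfolding A_def by (intro sets_PiM_I_finite) auto
  have step: "emeasure (IT.C 0 (Suc n) (\<lambda>_. undefined)) (A (Suc n)) =
      emeasure (srw_kernel E v n p) {p n} * emeasure (IT.C 0 n (\<lambda>_. undefined)) (A n)" for n
  proof -
    let ?u = "\<lambda>_::nat. undefined :: 'a"
    have u: "?u \<in> space (PiM {0..<0} ?M)"
      by (simp add: space_PiM)
    have eP: "emeasure (IT.eP n \<omega>) (A (Suc n)) =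
        emeasure (srw_kernel E v n p) {p n} * indicator (A n) \<omega>"
      if \<omega>: "\<omega> \<in> space (PiM {0..<n} ?M)" for \<omega>
    proof -
      have ext: "\<omega> i = undefined" if "\<not> i < n" for i
        using \<omega> that by (auto simp: space_PiM PiE_def extensional_def)
      have "(\<lambda>x. fun_upd \<omega> n x) -` A (Suc n) = (if \<omega> \<in> A n then {p n} else {})"
        using ext by (auto simp: A_def PiE_iff extensional_def atLeast0_lessThan_Suc)
      moreover have "srw_kernel E v n \<omega> = srw_kernel E v n p" if "\<omega> \<in> A n"
        using that by (cases n) (auto simp: srw_kernel_def A_def PiE_iff)
      ultimately show ?thesis
        by (simp add: IT.emeasure_eP[OF \<omega> A] split: split_indicator)
    qed
    have "emeasure (IT.C 0 (Suc n) ?u) (A (Suc n)) =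
        (\<integral>\<^sup>+\<omega>. emeasure (IT.eP n \<omega>) (A (Suc n)) \<partial>IT.C 0 n ?u)"
      using IT.prob_space_C[OF u, of n] IT.measurable_eP[of n] IT.sets_C[OF u, of n]
      by (simp add: emeasure_bind[where N = "PiM {0..<Suc n} ?M"] prob_space.not_empty
          cong: measurable_cong_sets)
    also have "\<dots> = (\<integral>\<^sup>+\<omega>. emeasure (srw_kernel E v n p) {p n} * indicator (A n) \<omega> \<partial>IT.C 0 n ?u)"
      by (intro nn_integral_cong eP) (simp add: IT.space_C[OF u])
    also have "\<dots> = emeasure (srw_kernel E v n p) {p n} * emeasure (IT.C 0 n ?u) (A n)"
      using IT.sets_C[OF u, of n] by (intro nn_integral_cmult_indicator) simp
    finally show ?thesis .
  qed
  have *: "emeasure (IT.C 0 (Suc n) (\<lambda>_. undefined)) (A (Suc n)) = indicator {v} (p 0) *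
      (\<Prod>i<n. ennreal (pmf (pmf_of_set {w. E (p i) w}) (p (Suc i))))" for n
  proof (induction n)
    case 0
    have "emeasure (IT.C 0 0 (\<lambda>_. undefined)) (A 0) = 1"
      by (simp add: A_def PiM_empty)
    moreover have "emeasure (srw_kernel E v 0 p) {p 0} = indicator {v} (p 0)"
      by (auto simp: srw_kernel_def emeasure_pmf_single pmf_return indicator_def)
    ultimately show ?case
      by (simp add: step del: IT.C.simps)
  next
    case (Suc n)
    have "emeasure (srw_kernel E v (Suc n) p) {p (Suc n)} =
        ennreal (pmf (pmf_of_set {w. E (p n) w}) (p (Suc n)))"
      by (simp add: srw_kernel_def emeasure_pmf_single)
    then show ?case
      by (simp add: step[of "Suc n"] Suc.IH mult_ac del: IT.C.simps)
  qed
  have "{\<omega>. \<forall>i\<le>n. \<omega> i = p i} = IT.PF.emb UNIV {0..<Suc n} (A (Suc n))"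
    by (auto simp: A_def prod_emb_def space_PiM PiE_iff less_Suc_eq_le)
  then have "emeasure (srw E v) {\<omega>. \<forall>i\<le>n. \<omega> i = p i} = emeasure (IT.CI {0..<Suc n}) (A (Suc n))"
    unfolding srw_def using IT.lim[OF _ A] by simp
  also have "\<dots> = emeasure (IT.C 0 (Suc n) (\<lambda>_. undefined)) (A (Suc n))"
    using IT.emeasure_CI[OF order.refl A[of "Suc n"]] A[of "Suc n", THEN sets.sets_into_space]
    by (simp add: prod_emb_id space_PiM del: IT.C.simps)
  finally show ?thesis
    by (simp only: *)
qed

lemma hitting_time_eq_enat_iff:
  "hitting_time A \<omega> = enat t \<longleftrightarrow> \<omega> t \<in> A \<and> (\<forall>s<t. \<omega> s \<notin> A)"
proof
  assume *: "hitting_time A \<omega> = enat t"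
  then have "{enat t |t. \<omega> t \<in> A} \<noteq> {}"
    by (auto simp: hitting_time_def Inf_enat_def split: if_splits)
  then have "hitting_time A \<omega> \<in> {enat t |t. \<omega> t \<in> A}"
    unfolding hitting_time_def by (meson all_not_in_conv wellorder_InfI)
  moreover have "hitting_time A \<omega> \<le> enat s" if "\<omega> s \<in> A" for s
    unfolding hitting_time_def using that by (intro Inf_lower) auto
  ultimately show "\<omega> t \<in> A \<and> (\<forall>s<t. \<omega> s \<notin> A)"
    using * by (force simp: not_less[symmetric])
next
  assume "\<omega> t \<in> A \<and> (\<forall>s<t. \<omega> s \<notin> A)"
  then show "hitting_time A \<omega> = enat t"
    unfolding hitting_time_def
    by (intro antisym Inf_lower Inf_greatest) (auto simp: not_less[symmetric])
qed

lemma sets_harmonic_measure: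
  "{\<omega>. \<exists>t. hitting_time A \<omega> = enat t \<and> \<omega> t = z} \<in> sets (srw E v)"
proof -
  have coord: "(\<lambda>\<omega>. \<omega> t) \<in> measurable (srw E v) (count_space UNIV)" for t
    unfolding measurable_cong_sets[OF sets_srw refl]
    by (rule measurable_component_singleton) simp
  have [measurable]: "Measurable.pred (srw E v) (\<lambda>\<omega>. \<omega> t \<in> S)"
      "Measurable.pred (srw E v) (\<lambda>\<omega>. \<omega> t \<notin> S)" "Measurable.pred (srw E v) (\<lambda>\<omega>. \<omega> t = z)" for t S
    by (rule measurable_compose[OF coord]; simp)+
  have "{\<omega> \<in> space (srw E v). \<exists>t. (\<omega> t \<in> A \<and> (\<forall>s<t. \<omega> s \<notin> A)) \<and> \<omega> t = z} \<in> sets (srw E v)"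
    by measurable
  then show ?thesis
    by (simp add: hitting_time_eq_enat_iff)
qed

section \<open>The two-dimensional comb\<close>

fun comb_adj :: "int \<times> int \<Rightarrow> int \<times> int \<Rightarrow> bool" where
  "comb_adj (x, y) (x', y') \<longleftrightarrow>
     x' = x \<and> \<bar>y' - y\<bar> = 1 \<or> y = 0 \<and> y' = 0 \<and> \<bar>x' - x\<bar> = 1"

lemma comb_neighbours:
  "{w. comb_adj (x, y) w} =
    {(x, y + 1), (x, y - 1)} \<union> (if y = 0 then {(x + 1, 0), (x - 1, 0)} else {})"
  by auto

definition comb_h :: "nat \<Rightarrow> int" where
  "comb_h x = \<lfloor>(real x + 1)\<^sup>2 / 3\<rfloor>"

definition comb_ball :: "nat \<Rightarrow> (int \<times> int) set" where
  "comb_ball m = {(x, y). \<bar>x\<bar> \<le> int m \<and> \<bar>y\<bar> \<le> comb_h (nat (int m - \<bar>x\<bar>))}"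

end

theory Submission
  imports Defs
begin

text \<open>
  The harmonic measure at a boundary point is the flux, out of the interior of \<open>B\<^sub>m\<close> into that point,
  of the Green function of the killed walk divided by the degree. This function \<open>u\<close> is harmonic away
  from the origin and vanishes on the boundary, so on each tooth it is linear: on the tooth over a
  spine vertex at distance \<open>k\<close> from the end of the spine it falls from its spine value to \<open>0\<close> in
  \<open>h(k)\<close> steps, and the flux into the tip is the slope. If the slope is to depend on \<open>k\<close> only, up to
  a constant that depends on \<open>m\<close>, then so does the spine value, say \<open>A\<^sub>k\<close>, and \<open>e(k) = A\<^sub>k / h(k)\<close>.
  Harmonicity at spine vertices other than the origin is then the recurrence
  \<open>A\<^bsub>k+1\<^esub> - 2 A\<^sub>k + A\<^bsub>k-1\<^esub> = 2 A\<^sub>k / h(k)\<close>, in which \<open>m\<close> does not appear. With \<open>A\<^sub>0 = 0\<close>, \<open>A\<^sub>1 = 1\<close> it has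
  a unique solution (\<open>spine_potential\<close>), and for each \<open>m\<close> the value of the Laplacian at the origin
  only fixes the scaling constant (\<open>harmonic_measure_comb_ball\<close>).

  The flux of any nonnegative solution \<open>u\<close> of the discrete Poisson equation with unit source is the
  harmonic measure (\<open>harmonic_measure_eq_potential_flux\<close>), by a domination argument. The expected numbers of visits before time \<open>n\<close> satisfy the
  same equation iteratively, starting from \<open>0\<close>, so \<open>u\<close> times the degree dominates them. Hence the
  probability of survival tends to \<open>0\<close>. As the fluxes into the boundary points sum to \<open>1\<close>, and each
  dominates the probability of having been absorbed there, the two must agree.

  For the asymptotics, write \<open>n = k + 1\<close>. Then \<open>(n\<^sup>2 - 1) / 3 \<le> h(k) \<le> n\<^sup>2 / 3\<close>, and the recurrence with
  \<open>n\<^sup>2 / 3\<close> or \<open>(n\<^sup>2 - 1) / 3\<close> in place of \<open>h\<close> is solved exactly by \<open>n\<^sup>3\<close> and by \<open>n\<^sup>3 - n\<close>. A discrete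
  Wronskian comparison shows that \<open>A\<^sub>k / n\<^sup>3\<close> never decreases and, for \<open>k \<ge> 1\<close>, \<open>A\<^sub>k / (n\<^sup>3 - n)\<close>
  never increases. The first ratio therefore has a positive finite limit \<open>L\<close>, and \<open>e(k) / k\<close> tends to \<open>3 L\<close>. The second ratio is \<open>1/6\<close> at
  \<open>k = 1, 2\<close>, which would only give \<open>c \<le> 1/2\<close>; but \<open>h(2) = 3\<close> exceeds \<open>(3\<^sup>2 - 1) / 3\<close>, the ratio drops to
  \<open>29/180\<close> at \<open>k = 3\<close>, and so \<open>c \<le> 29/60\<close>.
\<close>

section \<open>The walk killed on leaving a set\<close>

text \<open>The position at time \<open>t\<close> itself is not required to lie in \<open>I\<close>: if \<open>w\<close> is outside \<open>I\<close>, this is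
  the event that the walk is outside \<open>I\<close> for the first time at time \<open>t\<close>, and is then at \<open>w\<close>.\<close>

definition killed_event :: "'v set \<Rightarrow> nat \<Rightarrow> 'v \<Rightarrow> (nat \<Rightarrow> 'v) set" where
  "killed_event I t w = {\<omega>. (\<forall>s<t. \<omega> s \<in> I) \<and> \<omega> t = w}"

definition killed_prob :: "('v \<Rightarrow> 'v \<Rightarrow> bool) \<Rightarrow> 'v \<Rightarrow> 'v set \<Rightarrow> nat \<Rightarrow> 'v \<Rightarrow> real" where
  "killed_prob E v I t w = measure (srw E v) (killed_event I t w)"

lemma measurable_srw_coordinate: "(\<lambda>\<omega>. \<omega> t) \<in> measurable (srw E v) (count_space UNIV)"
  unfolding measurable_cong_sets[OF sets_srw refl]
  by (rule measurable_component_singleton) simp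

lemma sets_killed_event [measurable]: "killed_event I t w \<in> sets (srw E v)"
proof -
  have [measurable]: "Measurable.pred (srw E v) (\<lambda>\<omega>. \<omega> s \<in> S)"
      "Measurable.pred (srw E v) (\<lambda>\<omega>. \<omega> s = a)" for s S a
    by (rule measurable_compose[OF measurable_srw_coordinate]; simp)+
  have "{\<omega> \<in> space (srw E v). (\<forall>s<t. \<omega> s \<in> I) \<and> \<omega> t = w} \<in> sets (srw E v)"
    by measurable
  then show ?thesis by (simp add: killed_event_def)
qed

lemma sets_cylinder: "{\<omega>. \<forall>i\<le>n. \<omega> i = p i} \<in> sets (srw E v)"
proof -
  have [measurable]: "Measurable.pred (srw E v) (\<lambda>\<omega>. \<omega> s = a)" for s a
    by (rule measurable_compose[OF measurable_srw_coordinate]; simp)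
  have "{\<omega> \<in> space (srw E v). \<forall>i\<le>n. \<omega> i = p i} \<in> sets (srw E v)"
    by measurable
  then show ?thesis by simp
qed

lemma measure_srw_cylinder:
  "measure (srw E v) {\<omega>. \<forall>i\<le>n. \<omega> i = p i} =
    indicator {v} (p 0) * (\<Prod>i<n. pmf (pmf_of_set {w. E (p i) w}) (p (Suc i)))"
  unfolding measure_def emeasure_srw_cylinder
  by (simp add: prod_ennreal enn2real_mult indicator_def prod_nonneg)

lemma killed_prob_0: "killed_prob E v I 0 w = (if w = v then 1 else 0)"
  using measure_srw_cylinder[of E v 0 "\<lambda>_. w"]
  by (simp add: killed_prob_def killed_event_def indicator_def)

text \<open>The Markov property, in the form of the forward equation. As \<open>I\<close> is finite, each event is a
  finite disjoint union of cylinders, one for every path of length \<open>t\<close> inside \<open>I\<close>, and appending a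
  last step to a cylinder multiplies its probability by the transition probability.\<close>

lemma killed_prob_Suc:
  assumes "finite I"
  shows "killed_prob E v I (Suc t) w =
    (\<Sum>a\<in>I. killed_prob E v I t a * pmf (pmf_of_set {b. E a b}) w)"
proof -
  interpret prob_space "srw E v" by (rule prob_space_srw)
  (* The paths up to time t - 1; their values from time t on are set by function updates. *)
  define P where "P = PiE {..<t} (\<lambda>_. I)"
  define cyl where "cyl n p = {\<omega>::nat \<Rightarrow> 'a. \<forall>i\<le>n. \<omega> i = p i}" for n p
  have fin: "finite P"
    unfolding P_def using assms by (intro finite_PiE) auto
  have eq: "p = q" if "p \<in> P" "q \<in> P" "\<And>i. i < t \<Longrightarrow> p i = q i" for p q
    using that unfolding P_def by (intro PiE_ext[of p _ _ q]) auto
  have rep: "\<exists>p\<in>P. \<forall>i<t. \<omega> i = p i" if "\<forall>s<t. \<omega> s \<in> I" for \<omega>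
    using that by (intro bexI[of _ "restrict \<omega> {..<t}"]) (auto simp: P_def)
  have P_I: "p i \<in> I" if "p \<in> P" "i < t" for p i
    using that by (auto simp: P_def PiE_iff)
  have measure_cyl_Union: "measure (srw E v) (\<Union>p\<in>P. cyl n (f p)) = (\<Sum>p\<in>P. measure (srw E v) (cyl n (f p)))"
    if "t \<le> n" and f: "\<And>p i. i < t \<Longrightarrow> f p i = p i" for n f
  proof (rule finite_measure_finite_Union[OF fin])
    show "(\<lambda>p. cyl n (f p)) ` P \<subseteq> sets (srw E v)"
      by (auto simp: cyl_def intro: sets_cylinder)
    show "disjoint_family_on (\<lambda>p. cyl n (f p)) P"
      unfolding disjoint_family_on_def
    proof (intro ballI impI, rule ccontr)
      fix p q assume pq: "p \<in> P" "q \<in> P" "p \<noteq> q" "cyl n (f p) \<inter> cyl n (f q) \<noteq> {}"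
      then obtain \<omega> where \<omega>: "\<omega> \<in> cyl n (f p)" "\<omega> \<in> cyl n (f q)" by blast
      have "p i = q i" if "i < t" for i
        using \<omega> that \<open>t \<le> n\<close> f[OF that, of p] f[OF that, of q] unfolding cyl_def
        by (auto dest!: spec[of _ i])
      with eq pq show False by blast
    qed
  qed
  have one: "killed_prob E v I t a = (\<Sum>p\<in>P. measure (srw E v) (cyl t (p(t := a))))" for a
  proof -
    have "killed_event I t a = (\<Union>p\<in>P. cyl t (p(t := a)))"
    proof (intro set_eqI iffI)
      fix \<omega> assume "\<omega> \<in> killed_event I t a"
      then show "\<omega> \<in> (\<Union>p\<in>P. cyl t (p(t := a)))"
        using rep[of \<omega>] by (fastforce simp: killed_event_def cyl_def)
    next
      fix \<omega> assume "\<omega> \<in> (\<Union>p\<in>P. cyl t (p(t := a)))"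
      then show "\<omega> \<in> killed_event I t a"
        using P_I by (fastforce simp: killed_event_def cyl_def)
    qed
    then show ?thesis
      unfolding killed_prob_def by (simp add: measure_cyl_Union)
  qed
  have two: "measure (srw E v) (\<Union>p\<in>P. cyl (Suc t) (p(t := a, Suc t := w))) =
      killed_prob E v I t a * pmf (pmf_of_set {b. E a b}) w" (is "measure _ ?U = _") for a
  proof -
    have "measure (srw E v) ?U =
        (\<Sum>p\<in>P. measure (srw E v) (cyl (Suc t) (p(t := a, Suc t := w))))"
      by (rule measure_cyl_Union) auto
    also have "\<dots> = (\<Sum>p\<in>P. measure (srw E v) (cyl t (p(t := a))) * pmf (pmf_of_set {b. E a b}) w)"
      unfolding cyl_def measure_srw_cylinder
      by (intro sum.cong refl) (auto intro!: prod.cong)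
    finally show ?thesis by (simp add: one sum_distrib_right)
  qed
  have "killed_event I (Suc t) w = (\<Union>a\<in>I. \<Union>p\<in>P. cyl (Suc t) (p(t := a, Suc t := w)))"
  proof (intro set_eqI iffI)
    fix \<omega> assume *: "\<omega> \<in> killed_event I (Suc t) w"
    then obtain p where p: "p \<in> P" "\<forall>i<t. \<omega> i = p i"
      using rep[of \<omega>] by (force simp: killed_event_def)
    then have "\<omega> \<in> cyl (Suc t) (p(t := \<omega> t, Suc t := w))"
      using * by (auto simp: cyl_def killed_event_def le_Suc_eq)
    then show "\<omega> \<in> (\<Union>a\<in>I. \<Union>p\<in>P. cyl (Suc t) (p(t := a, Suc t := w)))"
      using * p by (auto simp: killed_event_def)
  next
    fix \<omega> assume "\<omega> \<in> (\<Union>a\<in>I. \<Union>p\<in>P. cyl (Suc t) (p(t := a, Suc t := w)))"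
    then show "\<omega> \<in> killed_event I (Suc t) w"
      using P_I by (force simp: killed_event_def cyl_def less_Suc_eq)
  qed
  moreover have "disjoint_family_on (\<lambda>a. \<Union>p\<in>P. cyl (Suc t) (p(t := a, Suc t := w))) I"
    unfolding disjoint_family_on_def
  proof (intro ballI impI)
    fix a b :: 'a assume "a \<noteq> b"
    have "\<omega> t = a" if "\<omega> \<in> (\<Union>p\<in>P. cyl (Suc t) (p(t := a, Suc t := w)))" for \<omega> a
      using that by (auto simp: cyl_def)
    with \<open>a \<noteq> b\<close> show "(\<Union>p\<in>P. cyl (Suc t) (p(t := a, Suc t := w))) \<inter>
        (\<Union>p\<in>P. cyl (Suc t) (p(t := b, Suc t := w))) = {}"
      by blast
  qed
  moreover have "(\<Union>p\<in>P. cyl (Suc t) (p(t := a, Suc t := w))) \<in> sets (srw E v)" for a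
    unfolding cyl_def by (intro sets.finite_UN fin sets_cylinder)
  ultimately show ?thesis
    unfolding killed_prob_def[of E v I "Suc t"]
    using finite_measure_finite_Union[OF assms, of "\<lambda>a. \<Union>p\<in>P. cyl (Suc t) (p(t := a, Suc t := w))"]
    by (auto simp: two)
qed

section \<open>Harmonic measure as the flux of a potential\<close>

text \<open>Probabilistically \<open>u a\<close> is the expected number of visits to \<open>a\<close> before absorption, divided by the
  degree of \<open>a\<close>, and each visit to \<open>a\<close> is followed by a step to a given neighbour with probability
  one over the degree. The existence of a nonnegative \<open>u\<close> already forces the walk to be absorbed:
  it bounds the total time spent in the interior.\<close>

lemma harmonic_measure_eq_potential_flux:
  fixes E :: "'v \<Rightarrow> 'v \<Rightarrow> bool" and u :: "'v \<Rightarrow> real" and B :: "'v set"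
  defines "I \<equiv> B - inner_boundary E B"
  assumes fin: "finite B" and v: "v \<in> I"
    and deg: "\<And>a. a \<in> I \<Longrightarrow> \<exists>b. E a b"
    and nonneg: "\<And>a. a \<in> I \<Longrightarrow> 0 \<le> u a"
    and potential: "\<And>a. a \<in> I \<Longrightarrow>
      real (card {b. E a b}) * u a = (if a = v then 1 else 0) + sum u {b \<in> I. E b a}"
    and z: "z \<in> inner_boundary E B"
  shows "harmonic_measure E B v z = sum u {b \<in> I. E b z}"
proof -
  interpret prob_space "srw E v" by (rule prob_space_srw)
  define D where "D = inner_boundary E B"
  define d where "d a = real (card {b. E a b})" for a
  define q where "q = killed_prob E v I"
  define \<phi> where "\<phi> a = sum u {b \<in> I. E b a}" for a
  have DB: "D \<subseteq> B" by (auto simp: D_def inner_boundary_def)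
  have BID: "B = I \<union> D" "I \<inter> D = {}" using DB by (auto simp: I_def D_def)
  have finI: "finite I" and finD: "finite D" using fin BID by auto
  have nbr: "{b. E a b} \<subseteq> B" if "a \<in> I" for a
    using that by (auto simp: I_def inner_boundary_def)
  have dpos: "d a > 0" if "a \<in> I" for a
    using deg[of a] that nbr[OF that] finite_subset[OF nbr[OF that] fin]
    by (auto simp: d_def card_gt_0_iff)
  have K: "pmf (pmf_of_set {b. E a b}) b = (if E a b then 1 / d a else 0)" if "a \<in> I" for a b
    using deg[of a] that finite_subset[OF nbr[OF that] fin]
    by (auto simp: d_def pmf_of_set)
  have q0: "q 0 a = (if a = v then 1 else 0)" for a
    by (simp add: q_def killed_prob_0)
  have qSuc: "q (Suc t) b = (\<Sum>a\<in>{a \<in> I. E a b}. q t a / d a)" for t b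
  proof -
    have "q (Suc t) b = (\<Sum>a\<in>I. if E a b then q t a / d a else 0)"
      unfolding q_def killed_prob_Suc[OF finI] by (intro sum.cong) (auto simp: K)
    then show ?thesis using finI by (simp add: sum.inter_filter)
  qed
  have qnn: "0 \<le> q t a" for t a by (simp add: q_def killed_prob_def)
  (* The expected number of visits to a before time n by the killed walk. *)
  define G where "G n a = (\<Sum>t<n. q t a)" for n a
  have GSuc: "G (Suc n) b = (if b = v then 1 else 0) + (\<Sum>a\<in>{a \<in> I. E a b}. G n a / d a)" for n b
  proof -
    have "G (Suc n) b = q 0 b + (\<Sum>t<n. q (Suc t) b)"
      by (simp add: G_def sum.lessThan_Suc_shift del: sum.lessThan_Suc)
    also have "(\<Sum>t<n. q (Suc t) b) = (\<Sum>a\<in>{a \<in> I. E a b}. G n a / d a)"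
      unfolding qSuc by (subst sum.swap) (simp add: G_def sum_divide_distrib)
    finally show ?thesis by (simp add: q0)
  qed
  (* Both sides solve the Poisson equation, G iteratively from 0, so G stays below. *)
  have GI: "G n a \<le> d a * u a" if "a \<in> I" for n a
    using that
  proof (induction n arbitrary: a)
    case 0
    then show ?case using dpos[of a] nonneg[of a] by (simp add: G_def)
  next
    case (Suc n)
    have "(\<Sum>b\<in>{b \<in> I. E b a}. G n b / d b) \<le> sum u {b \<in> I. E b a}"
      using Suc.IH dpos by (intro sum_mono) (auto simp: divide_le_eq mult.commute)
    then show ?case
      using potential[of a] Suc.prems by (simp add: GSuc d_def)
  qed
  have GD: "G n a \<le> \<phi> a" if "a \<in> D" for n a
  proof (cases n)
    case 0
    then show ?thesis using nonneg by (auto simp: G_def \<phi>_def intro!: sum_nonneg)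
  next
    case (Suc n)
    have "a \<noteq> v" using that v BID(2) by auto
    moreover have "(\<Sum>b\<in>{b \<in> I. E b a}. G n b / d b) \<le> sum u {b \<in> I. E b a}"
      using GI dpos by (intro sum_mono) (auto simp: divide_le_eq mult.commute)
    ultimately show ?thesis by (simp add: GSuc Suc \<phi>_def)
  qed
  have out: "(\<Sum>b\<in>B. if E a b then c else 0) = d a * c" if "a \<in> I" for a and c :: real
  proof -
    have "{b \<in> B. E a b} = {b. E a b}" using nbr[OF that] by auto
    then show ?thesis using fin by (simp add: sum.inter_filter[symmetric] d_def)
  qed
  (* No edge from the interior leaves B, so summing inflow over B counts each a once per edge. *)
  have swap: "(\<Sum>b\<in>B. sum f {a \<in> I. E a b}) = (\<Sum>a\<in>I. d a * f a)" for f :: "'v \<Rightarrow> real"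
  proof -
    have "(\<Sum>b\<in>B. sum f {a \<in> I. E a b}) = (\<Sum>b\<in>B. \<Sum>a\<in>I. if E a b then f a else 0)"
      using finI by (simp add: sum.inter_filter)
    also have "\<dots> = (\<Sum>a\<in>I. \<Sum>b\<in>B. if E a b then f a else 0)" by (rule sum.swap)
    finally show ?thesis by (simp add: out)
  qed
  have split: "sum f B = sum f I + sum f D" for f :: "'v \<Rightarrow> real"
    using BID finI finD by (simp add: sum.union_disjoint)
  (* Gauss's theorem: the total flux through the boundary is the strength of the source. *)
  have flux: "sum \<phi> D = 1"
  proof -
    have "sum \<phi> I + sum \<phi> D = (\<Sum>a\<in>I. d a * u a)"
      using swap[of u] split[of \<phi>] by (simp add: \<phi>_def)
    also have "\<dots> = (\<Sum>a\<in>I. (if a = v then 1 else 0) + \<phi> a)"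
      using potential by (intro sum.cong) (auto simp: d_def \<phi>_def)
    also have "\<dots> = 1 + sum \<phi> I"
      using finI v by (simp add: sum.distrib)
    finally show ?thesis by simp
  qed
  (* At every time the walk is either still in the interior or has been absorbed on D. *)
  have mass: "sum (q n) I + (\<Sum>b\<in>D. G (Suc n) b) = 1" for n
  proof (induction n)
    case 0
    have "(\<Sum>b\<in>D. G (Suc 0) b) = 0"
      using v BID(2) by (intro sum.neutral) (auto simp: G_def q0)
    then show ?case using finI v by (simp add: q0)
  next
    case (Suc n)
    have "sum (q (Suc n)) I + sum (q (Suc n)) D = (\<Sum>a\<in>I. d a * (q n a / d a))"
      using swap[of "\<lambda>a. q n a / d a"] split[of "q (Suc n)"] by (simp add: qSuc)
    also have "\<dots> = sum (q n) I"
      using dpos by (intro sum.cong) fastforce+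
    finally show ?case
      using Suc by (simp add: G_def sum.distrib)
  qed
  have "summable (\<lambda>t. sum (q t) I)"
  proof (rule summableI_nonneg_bounded)
    show "0 \<le> sum (q n) I" for n by (simp add: sum_nonneg qnn)
    show "(\<Sum>t<n. sum (q t) I) \<le> (\<Sum>a\<in>I. d a * u a)" for n
      by (subst sum.swap) (use GI in \<open>auto simp: G_def intro!: sum_mono\<close>)
  qed
  then have decay: "(\<lambda>t. sum (q t) I) \<longlonglongrightarrow> 0" by (rule summable_LIMSEQ_zero)
  define \<nu> where "\<nu> = harmonic_measure E B v"
  have hit: "G n b \<le> \<nu> b" if "b \<in> D" for n b
  proof -
    have "disjoint_family_on (\<lambda>t. killed_event I t b) {..<n}"
      unfolding disjoint_family_on_def
    proof (intro ballI impI)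
      fix s t :: nat assume "s \<noteq> t"
      then show "killed_event I s b \<inter> killed_event I t b = {}"
        using that BID(2) by (auto simp: killed_event_def neq_iff)
    qed
    then have "G n b = measure (srw E v) (\<Union>t<n. killed_event I t b)"
      unfolding G_def q_def killed_prob_def
      by (intro finite_measure_finite_Union[symmetric]) auto
    also have "\<dots> \<le> \<nu> b"
      unfolding \<nu>_def harmonic_measure_def hitting_time_eq_enat_iff
    proof (intro finite_measure_mono)
      show "(\<Union>t<n. killed_event I t b) \<subseteq> {\<omega>. \<exists>t. (\<omega> t \<in> inner_boundary E B \<and>
          (\<forall>s<t. \<omega> s \<notin> inner_boundary E B)) \<and> \<omega> t = b}"
        using that BID(2) by (auto simp: killed_event_def D_def)
      show "{\<omega>. \<exists>t. (\<omega> t \<in> inner_boundary E B \<and>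
          (\<forall>s<t. \<omega> s \<notin> inner_boundary E B)) \<and> \<omega> t = b} \<in> sets (srw E v)"
        using sets_harmonic_measure[of "inner_boundary E B" b E v]
        by (simp only: hitting_time_eq_enat_iff)
    qed
    finally show ?thesis .
  qed
  (* The total flux is 1, so the mass absorbed at b by time n is 1 minus the surviving mass and
     minus the mass absorbed elsewhere; the latter is at most the flux through the other points. *)
  have low: "\<phi> b \<le> \<nu> b" if "b \<in> D" for b
  proof -
    have "\<phi> b - sum (q n) I \<le> \<nu> b" for n
    proof -
      have "sum (G (Suc n)) (D - {b}) \<le> sum \<phi> (D - {b})"
        using GD by (intro sum_mono) auto
      then have "\<phi> b - sum (q n) I \<le> G (Suc n) b"
        using mass[of n] flux that finD by (simp add: sum.remove[of D b])
      with hit[OF that, of "Suc n"] show ?thesis by simp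
    qed
    moreover have "(\<lambda>n. \<phi> b - sum (q n) I) \<longlonglongrightarrow> \<phi> b - 0"
      by (intro tendsto_intros decay)
    ultimately show ?thesis
      using LIMSEQ_le_const2[of "\<lambda>n. \<phi> b - sum (q n) I" "\<phi> b - 0" "\<nu> b"] by auto
  qed
  have "sum \<nu> D \<le> 1"
  proof -
    let ?H = "\<lambda>b. {\<omega>. \<exists>t. hitting_time (inner_boundary E B) \<omega> = enat t \<and> \<omega> t = b}"
    have "disjoint_family_on ?H D"
      by (auto simp: disjoint_family_on_def)
    then have "sum \<nu> D = measure (srw E v) (\<Union>b\<in>D. ?H b)"
      unfolding \<nu>_def harmonic_measure_def
      by (intro finite_measure_finite_Union[symmetric] finD) (auto intro: sets_harmonic_measure)
    then show ?thesis by simp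
  qed
  moreover have "sum \<phi> (D - {z}) \<le> sum \<nu> (D - {z})"
    using low by (intro sum_mono) auto
  ultimately have "\<nu> z \<le> \<phi> z"
    using flux z sum.remove[OF finD, of z \<nu>] sum.remove[OF finD, of z \<phi>] by (simp add: D_def)
  with low[of z] z show ?thesis
    by (simp add: \<nu>_def \<phi>_def D_def)
qed

section \<open>The potential on the spine\<close>

text \<open>The lower bound uses that squares are \<open>0\<close> or \<open>1\<close> modulo \<open>3\<close>, so the floor removes at most \<open>1/3\<close>.\<close>

lemma comb_h_bounds:
  "3 * comb_h k \<le> (int k + 1)\<^sup>2" "(int k + 1)\<^sup>2 - 1 \<le> 3 * comb_h k"
proof -
  have h: "comb_h k = (int k + 1)\<^sup>2 div 3"
  proof -
    have "comb_h k = \<lfloor>real_of_int ((int k + 1)\<^sup>2) / real_of_int 3\<rfloor>"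
      by (simp add: comb_h_def)
    then show ?thesis by (simp only: floor_divide_of_int_eq)
  qed
  show "3 * comb_h k \<le> (int k + 1)\<^sup>2" unfolding h by linarith
  have "(int k + 1) mod 3 = 0 \<or> (int k + 1) mod 3 = 1 \<or> (int k + 1) mod 3 = 2" by presburger
  then have "(int k + 1)\<^sup>2 mod 3 \<le> 1"
    by (auto simp: power_mod[of "int k + 1" 3 2, symmetric])
  then show "(int k + 1)\<^sup>2 - 1 \<le> 3 * comb_h k" unfolding h by presburger
qed

lemma comb_h_0 [simp]: "comb_h 0 = 0"
  by (simp add: comb_h_def)

lemma comb_h_1 [simp]: "comb_h (Suc 0) = 1"
  by (simp add: comb_h_def)

lemma comb_h_2: "comb_h 2 = 3"
  by (simp add: comb_h_def)

lemma comb_h_pos: "0 < k \<Longrightarrow> 1 \<le> comb_h k"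
proof -
  assume "0 < k"
  then have "(2::int)\<^sup>2 \<le> (int k + 1)\<^sup>2" by (intro power_mono) auto
  then show ?thesis using comb_h_bounds(2)[of k] by simp
qed

lemma comb_h_nonneg: "0 \<le> comb_h k"
  by (simp add: comb_h_def)

text \<open>The argument is the distance to the end of the spine, where the potential vanishes. The
  recurrence is harmonicity at a spine vertex of degree four: its two neighbours on the tooth have
  potential \<open>1 - 1 / h\<close> times its own.\<close>

fun spine_potential :: "nat \<Rightarrow> real" where
  "spine_potential 0 = 0"
| "spine_potential (Suc 0) = 1"
| "spine_potential (Suc (Suc k)) =
    (2 + 2 / comb_h (Suc k)) * spine_potential (Suc k) - spine_potential k"

text \<open>The slope of the potential along a tooth. At \<open>k = 0\<close> there is no tooth, and the boundary point
  ends the spine itself; the flux into it is the drop of the potential along the last spine edge,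
  \<open>spine_potential 1 - spine_potential 0\<close>.\<close>

definition tip_weight :: "nat \<Rightarrow> real" where
  "tip_weight k = (if k = 0 then 1 else spine_potential k / comb_h k)"

text \<open>The recurrence makes the sequence convex as long as it is nonnegative, so its increments never
  fall below the first one.\<close>

lemma spine_potential_increment_ge_1: "spine_potential k + 1 \<le> spine_potential (Suc k) \<and> 0 \<le> spine_potential k"
proof (induction k)
  case (Suc k)
  have "0 \<le> 2 / comb_h (Suc k) * spine_potential (Suc k)"
    using Suc comb_h_nonneg[of "Suc k"] by simp
  with Suc show ?case by (simp add: distrib_right)
qed simp

lemma spine_potential_pos: "0 < k \<Longrightarrow> 0 < spine_potential k"
  using spine_potential_increment_ge_1[of "k - 1"] by simp

lemma tip_weight_pos: "0 < tip_weight k"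
  using spine_potential_pos[of k] comb_h_pos[of k] by (auto simp: tip_weight_def)

lemma tip_weight_mult_comb_h: "tip_weight k * comb_h k = spine_potential k"
  using comb_h_pos[of k] by (cases "k = 0") (auto simp: tip_weight_def)

lemma spine_potential_recurrence:
  "0 < k \<Longrightarrow> spine_potential (k + 1) + spine_potential (k - 1) =
    2 * spine_potential k + 2 * tip_weight k"
  by (cases k) (auto simp: tip_weight_def algebra_simps)

section \<open>Growth of the spine potential\<close>

text \<open>With \<open>n = k + 1\<close>, the cubes have second difference \<open>6 n\<close>, which is \<open>2 / (n\<^sup>2 / 3)\<close> times \<open>n\<^sup>3\<close>. As
  \<open>h \<le> n\<^sup>2 / 3\<close>, the potential is relatively at least as convex, and its Wronskian with the cubes stays
  nonnegative.\<close>

lemma spine_potential_div_cube_mono: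
  "spine_potential k / (real k + 1) ^ 3 \<le> spine_potential (Suc k) / (real k + 2) ^ 3"
proof -
  have "0 \<le> spine_potential (Suc k) * (real k + 1) ^ 3 - spine_potential k * (real k + 2) ^ 3"
  proof (induction k)
    case (Suc k)
    let ?n = "real k + 2" and ?A = "spine_potential (Suc k)" and ?h = "real_of_int (comb_h (Suc k))"
    have h: "?h \<ge> 1" using comb_h_pos[of "Suc k"] by simp
    have hb: "3 * ?h \<le> ?n\<^sup>2"
      using comb_h_bounds(1)[of "Suc k"]
      unfolding of_int_le_iff[where 'a = real, symmetric] by (simp add: add.commute)
    have "6 * ?n \<le> 2 / ?h * ?n ^ 3"
    proof -
      have "?n * (3 * ?h) \<le> ?n * ?n\<^sup>2" by (intro mult_left_mono hb) simp
      then show ?thesis using h by (simp add: field_simps power2_eq_square power3_eq_cube)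
    qed
    then have "?A * (6 * ?n) \<le> ?A * (2 / ?h * ?n ^ 3)"
      using spine_potential_increment_ge_1[of "Suc k"] by (intro mult_left_mono) auto
    moreover have "spine_potential (Suc (Suc k)) * ?n ^ 3 - ?A * (real k + 3) ^ 3 =
        (?A * (real k + 1) ^ 3 - spine_potential k * ?n ^ 3)
        + (?A * (2 / ?h * ?n ^ 3) - ?A * (6 * ?n))"
      by (simp add: algebra_simps power3_eq_cube)
    ultimately show ?case using Suc by (simp add: add.commute)
  qed simp
  then show ?thesis by (simp add: field_simps)
qed

text \<open>Here the comparison is with \<open>n\<^sup>3 - n\<close>, whose second difference \<open>6 n\<close> is \<open>2 / ((n\<^sup>2 - 1) / 3)\<close> times
  its value, so \<open>h \<ge> (n\<^sup>2 - 1) / 3\<close> reverses the inequality. The comparison is started at \<open>k = 3\<close>,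
  the first index at which the ratio is below \<open>1/6\<close>: it is \<open>(29/3) / 60 = 29/180\<close> there.\<close>

lemma spine_potential_upper_bound:
  "spine_potential (k + 3) \<le> 29 / 180 * (real k + 4) ^ 3"
proof -
  define D where "D n = n ^ 3 - n" for n :: real
  have Dpos: "0 < D (real k + 2)" for k
    unfolding D_def by (simp add: algebra_simps power3_eq_cube) (smt (verit) of_nat_0_le_iff mult_nonneg_nonneg)
  have cross: "spine_potential (Suc k) * D (real k + 1) \<le> spine_potential k * D (real k + 2)" for k
  proof (induction k)
    case 0
    then show ?case by (simp add: D_def)
  next
    case (Suc k)
    let ?n = "real k + 2" and ?A = "spine_potential (Suc k)" and ?h = "real_of_int (comb_h (Suc k))"
    have h: "?h \<ge> 1" using comb_h_pos[of "Suc k"] by simp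
    have hb: "?n\<^sup>2 - 1 \<le> 3 * ?h"
      using comb_h_bounds(2)[of "Suc k"]
      unfolding of_int_le_iff[where 'a = real, symmetric] by (simp add: add.commute)
    have "2 / ?h * D ?n \<le> 6 * ?n"
    proof -
      have "?n * (?n\<^sup>2 - 1) \<le> ?n * (3 * ?h)" by (intro mult_left_mono hb) simp
      then show ?thesis using h by (simp add: D_def field_simps power2_eq_square power3_eq_cube)
    qed
    then have "?A * (2 / ?h * D ?n) \<le> ?A * (6 * ?n)"
      using spine_potential_increment_ge_1[of "Suc k"] by (intro mult_left_mono) auto
    moreover have "spine_potential (Suc (Suc k)) * D ?n - ?A * D (real k + 3) =
        (?A * D (real k + 1) - spine_potential k * D ?n)
        + (?A * (2 / ?h * D ?n) - ?A * (6 * ?n))"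
      by (simp add: D_def algebra_simps power3_eq_cube)
    ultimately show ?case using Suc by (simp add: add.commute)
  qed
  have "spine_potential (k + 3) \<le> 29 / 180 * D (real k + 4)"
  proof (induction k)
    case 0
    have "spine_potential 3 = 29 / 3"
      by (simp add: numeral_3_eq_3 comb_h_2[unfolded numeral_2_eq_2])
    then show ?case by (simp add: D_def)
  next
    case (Suc k)
    have "spine_potential (Suc k + 3) * D (real k + 4) \<le> spine_potential (k + 3) * D (real k + 5)"
      using cross[of "k + 3"] by (simp add: add.commute)
    also have "\<dots> \<le> 29 / 180 * D (real k + 4) * D (real k + 5)"
      using Suc Dpos[of "k + 3"] by (intro mult_right_mono) (auto simp: add.commute)
    finally have "spine_potential (Suc k + 3) * D (real k + 4) \<le>
        (29 / 180 * D (real k + 5)) * D (real k + 4)" by (simp add: mult_ac)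
    then have "spine_potential (Suc k + 3) \<le> 29 / 180 * D (real k + 5)"
      using Dpos[of "k + 2"] by (simp add: add.commute)
    then show ?case by (simp add: add.commute)
  qed
  then show ?thesis by (simp add: D_def)
qed

text \<open>The limit is \<open>3 L\<close>, where \<open>L\<close> is the limit of the nondecreasing ratio of the potential to the cubes,
  and \<open>1/8 \<le> L \<le> 29/180\<close>.\<close>

lemma tip_weight_asymptotics:
  "\<exists>c. 0 < c \<and> c < 1 / 2 \<and> (\<lambda>k. tip_weight k / real k) \<longlonglongrightarrow> c"
proof -
  define r where "r k = spine_potential k / (real k + 1) ^ 3" for k
  have inc: "incseq r"
    using spine_potential_div_cube_mono by (intro incseq_SucI) (simp add: r_def add.commute)
  have ub: "r (k + 3) \<le> 29 / 180" for k
    using spine_potential_upper_bound[of k] by (simp add: r_def divide_le_eq add.commute)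
  have ub': "r k \<le> 29 / 180" for k
    using ub[of k] incseqD[OF inc, of k "k + 3"] by simp
  obtain L where L: "r \<longlonglongrightarrow> L" "\<And>i. r i \<le> L"
    using incseq_convergent[OF inc, of "29/180"] ub' by auto
  have L1: "1 / 8 \<le> L" using L(2)[of 1] by (simp add: r_def)
  have L2: "L \<le> 29 / 180" using LIMSEQ_le_const2[OF L(1), of "29 / 180"] ub' by blast
  define g where "g k = (real k + 1)\<^sup>2 / comb_h k" for k
  have g: "g \<longlonglongrightarrow> 3"
  proof (rule tendsto_sandwich)
    show "(\<lambda>k. 3 :: real) \<longlonglongrightarrow> 3" by simp
    show "(\<lambda>k. 3 + 1 / real k) \<longlonglongrightarrow> 3"
      using tendsto_add[OF tendsto_const[of "3::real"] lim_1_over_n] by simp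
    have "3 \<le> g k \<and> g k \<le> 3 + 1 / real k" if "k > 0" for k
    proof -
      let ?h = "real_of_int (comb_h k)"
      have h: "?h \<ge> 1" using comb_h_pos[OF that] by simp
      have b: "3 * ?h \<le> (real k + 1)\<^sup>2" "(real k + 1)\<^sup>2 - 1 \<le> 3 * ?h"
        using comb_h_bounds[of k] unfolding of_int_le_iff[where 'a = real, symmetric] by simp_all
      have "1 * real k \<le> real k * real k" using that by (intro mult_mono) auto
      then have "3 * real k \<le> 3 * ?h" using b(2) by (simp add: power2_eq_square algebra_simps)
      then have "1 / ?h \<le> 1 / real k" using that h by (intro divide_left_mono) auto
      moreover have "g k \<le> 3 + 1 / ?h" using b h by (simp add: g_def field_simps)
      moreover have "3 \<le> g k" using b h by (simp add: g_def field_simps)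
      ultimately show ?thesis by simp
    qed
    then show "\<forall>\<^sub>F k in sequentially. 3 \<le> g k" "\<forall>\<^sub>F k in sequentially. g k \<le> 3 + 1 / real k"
      by (auto intro!: eventually_sequentiallyI[of 1])
  qed
  (* With n = k + 1: A / (h k) = (A / n^3) (n^2 / h) (n / k). *)
  have "(\<lambda>k. r k * g k * (1 + 1 / real k)) \<longlonglongrightarrow> L * 3 * (1 + 0)"
    by (intro tendsto_intros L g lim_1_over_n)
  moreover have "\<forall>\<^sub>F k in sequentially. r k * g k * (1 + 1 / real k) = tip_weight k / real k"
    using eventually_gt_at_top[of 0]
  proof eventually_elim
    case (elim k)
    have "a / n ^ 3 * (n\<^sup>2 / h) * (n / real k) = a / h / real k" if "n \<noteq> 0" for a n h :: real
      using that by (simp add: power2_eq_square power3_eq_cube)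
    moreover have "1 + 1 / real k = (real k + 1) / real k"
      using elim by (simp add: field_simps)
    ultimately show ?case
      using elim by (simp add: r_def g_def tip_weight_def)
  qed
  ultimately have "(\<lambda>k. tip_weight k / real k) \<longlonglongrightarrow> 3 * L"
    by (simp add: tendsto_cong mult.commute)
  then show ?thesis using L1 L2 by (intro exI[of _ "3 * L"]) auto
qed

section \<open>Harmonic measure of the comb balls\<close>

text \<open>Only the tips of the teeth, and the two ends of the spine, are boundary points: an inner spine
  vertex has a spine neighbour further out, and that one still lies in the ball because \<open>h\<close> is
  nonnegative.\<close>

lemma inner_boundary_comb_ball:
  "inner_boundary comb_adj (comb_ball m) =
    {(x, y). \<bar>x\<bar> \<le> int m \<and> \<bar>y\<bar> = comb_h (nat (int m - \<bar>x\<bar>))}" (is "_ = ?R")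
proof (intro set_eqI iffI)
  fix z assume z: "z \<in> inner_boundary comb_adj (comb_ball m)"
  obtain x y where xy: "z = (x, y)" by (cases z)
  let ?h = "comb_h (nat (int m - \<bar>x\<bar>))"
  obtain w where w: "comb_adj (x, y) w" "w \<notin> comb_ball m"
    using z unfolding inner_boundary_def xy by blast
  have B: "\<bar>x\<bar> \<le> int m" "\<bar>y\<bar> \<le> ?h"
    using z by (simp_all add: inner_boundary_def xy comb_ball_def)
  show "z \<in> ?R"
  proof (rule ccontr)
    assume "z \<notin> ?R"
    with B have y: "\<bar>y\<bar> < ?h" by (auto simp: xy)
    then have "\<bar>x\<bar> \<noteq> int m" by (auto simp: comb_ball_def)
    with y w B show False
      using comb_h_nonneg by (cases w) (auto simp: comb_ball_def)
  qed
next
  fix z assume z: "z \<in> ?R"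
  obtain x y where xy: "z = (x, y)" by (cases z)
  have "comb_adj (x, y) (x, if y \<ge> 0 then y + 1 else y - 1)" by simp
  moreover have "(x, if y \<ge> 0 then y + 1 else y - 1) \<notin> comb_ball m"
    using z by (auto simp: comb_ball_def xy)
  moreover have "z \<in> comb_ball m" using z by (auto simp: comb_ball_def xy)
  ultimately show "z \<in> inner_boundary comb_adj (comb_ball m)"
    unfolding inner_boundary_def xy by blast
qed

lemma finite_comb_ball: "finite (comb_ball m)"
proof -
  have "comb_ball m \<subseteq> Sigma {-int m..int m} (\<lambda>x. {-comb_h (nat (int m - \<bar>x\<bar>))..comb_h (nat (int m - \<bar>x\<bar>))})"
    by (auto simp: comb_ball_def)
  then show ?thesis by (rule finite_subset) auto
qed

text \<open>For \<open>m = 0\<close> the ball is just the origin, which is then a boundary point, so the walk is stopped at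
  time \<open>0\<close>.\<close>

lemma harmonic_measure_comb_ball_0:
  "z \<in> inner_boundary comb_adj (comb_ball 0) \<Longrightarrow>
    harmonic_measure comb_adj (comb_ball 0) (0, 0) z = 1"
proof -
  assume z: "z \<in> inner_boundary comb_adj (comb_ball 0)"
  interpret prob_space "srw comb_adj (0,0)" by (rule prob_space_srw)
  have z0: "z = (0, 0)" using z by (auto simp: inner_boundary_comb_ball)
  have "1 = measure (srw comb_adj (0,0)) (killed_event {} 0 (0,0))"
    using killed_prob_0[of comb_adj "(0,0)" "{}" "(0,0)"] by (simp add: killed_prob_def)
  also have "\<dots> \<le> harmonic_measure comb_adj (comb_ball 0) (0, 0) z"
    unfolding harmonic_measure_def
    using z by (intro finite_measure_mono sets_harmonic_measure)
      (auto simp: killed_event_def z0 hitting_time_eq_enat_iff intro!: exI[of _ 0])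
  finally show ?thesis by (simp add: harmonic_measure_def antisym)
qed

definition comb_potential :: "nat \<Rightarrow> int \<times> int \<Rightarrow> real" where
  "comb_potential m = (\<lambda>(x, y). tip_weight (nat (int m - \<bar>x\<bar>)) *
     of_int (comb_h (nat (int m - \<bar>x\<bar>)) - \<bar>y\<bar>))"

text \<open>The function \<open>comb_potential m\<close> is harmonic in the interior except at the origin, where its
  outflow is \<open>S\<close>; dividing by \<open>S\<close> gives the potential of a unit source. Every boundary point has exactly
  one interior neighbour, and the potential there is the tip weight.\<close>

lemma harmonic_measure_comb_ball:
  assumes m: "0 < m"
  shows "\<exists>C>0. \<forall>z \<in> inner_boundary comb_adj (comb_ball m).
       harmonic_measure comb_adj (comb_ball m) (0, 0) z = C * tip_weight (nat (int m - \<bar>fst z\<bar>))"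
proof -
  define I where "I = comb_ball m - inner_boundary comb_adj (comb_ball m)"
  have I: "I = {(x, y). \<bar>x\<bar> \<le> int m \<and> \<bar>y\<bar> < comb_h (nat (int m - \<bar>x\<bar>))}"
    unfolding I_def inner_boundary_comb_ball by (auto simp: comb_ball_def)
  have I_strict: "\<bar>x\<bar> < int m" if "(x, y) \<in> I" for x y
    using that by (cases "\<bar>x\<bar> = int m") (auto simp: I)
  (* The outflow at the origin: two spine edges and two tooth edges. *)
  define S where "S = 2 * (spine_potential m - spine_potential (m - 1)) + 2 * tip_weight m"
  have S: "S > 0"
    using spine_potential_increment_ge_1[of "m - 1"] tip_weight_pos[of m] m by (simp add: S_def)
  define U where "U a = comb_potential m a / S" for a
  have nbrs_in: "{b. comb_adj a b} \<subseteq> comb_ball m" if "a \<in> I" for a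
    using that by (auto simp: I_def inner_boundary_def)
  (* The potential vanishes on the boundary, so the sum may run over all neighbours. *)
  have sumU: "sum U {b \<in> I. comb_adj b a} = sum U {b. comb_adj a b}" if "a \<in> I" for a
  proof (rule sum.mono_neutral_left)
    show "finite {b. comb_adj a b}" by (cases a) (simp add: comb_neighbours)
    show "{b \<in> I. comb_adj b a} \<subseteq> {b. comb_adj a b}" by (cases a) auto
    have "U b = 0" if "comb_adj a b" "b \<notin> I" for b
    proof -
      have "b \<in> inner_boundary comb_adj (comb_ball m)"
        using nbrs_in[OF \<open>a \<in> I\<close>] that by (auto simp: I_def)
      then show ?thesis
        by (auto simp: inner_boundary_comb_ball U_def comb_potential_def)
    qed
    then show "\<forall>b\<in>{b. comb_adj a b} - {b \<in> I. comb_adj b a}. U b = 0"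
      by (cases a) auto
  qed
  have potential: "real (card {b. comb_adj a b}) * U a =
      (if a = (0, 0) then 1 else 0) + sum U {b \<in> I. comb_adj b a}" if a: "a \<in> I" for a
  proof -
    obtain x y where xy: "a = (x, y)" by (cases a)
    define k where "k = nat (int m - \<bar>x\<bar>)"
    have k: "0 < k" using I_strict[of x y] a by (simp add: k_def xy)
    have pot: "comb_potential m (x, y') = tip_weight k * (comb_h k - \<bar>y'\<bar>)" for y'
      by (simp add: comb_potential_def k_def)
    have pot0: "comb_potential m (x', 0) = spine_potential (nat (int m - \<bar>x'\<bar>))" for x'
      by (simp add: comb_potential_def tip_weight_mult_comb_h)
    show ?thesis
    proof (cases "y = 0")
      case False
      have "{b. comb_adj a b} = {(x, y + 1), (x, y - 1)}"
        using False by (simp add: xy comb_neighbours)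
      moreover have "comb_potential m (x, y + 1) + comb_potential m (x, y - 1) = 2 * comb_potential m (x, y)"
      proof -
        have "\<bar>y + 1\<bar> + \<bar>y - 1\<bar> = 2 * \<bar>y\<bar>" using False by linarith
        then have "real_of_int \<bar>y + 1\<bar> + real_of_int \<bar>y - 1\<bar> = 2 * real_of_int \<bar>y\<bar>" by linarith
        then show ?thesis unfolding pot distrib_left[symmetric] by (simp add: algebra_simps)
      qed
      ultimately show ?thesis
        using False unfolding sumU[OF a]
        by (simp add: xy U_def add_divide_distrib[symmetric])
    next
      case True
      have N: "{b. comb_adj a b} = {(x, 1), (x, -1), (x + 1, 0), (x - 1, 0)}"
        using True by (auto simp: xy comb_neighbours)
      have "4 * comb_potential m (x, 0) = (if x = 0 then S else 0) + (comb_potential m (x, 1) +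
          comb_potential m (x, -1) + comb_potential m (x + 1, 0) + comb_potential m (x - 1, 0))"
      proof (cases "x = 0")
        case True
        then have "k = m" by (simp add: k_def)
        then have "comb_potential m (0, 1) = tip_weight m * (comb_h m - 1)"
            "comb_potential m (0, -1) = tip_weight m * (comb_h m - 1)"
          using pot[of 1] pot[of "-1"] True by simp_all
        moreover have "nat (int m - 1) = m - 1" by simp
        ultimately show ?thesis
          using True unfolding pot0 using m
          by (simp add: S_def tip_weight_mult_comb_h algebra_simps)
      next
        case False
        have "nat (int m - \<bar>x + 1\<bar>) = k - 1 \<and> nat (int m - \<bar>x - 1\<bar>) = k + 1 \<or>
            nat (int m - \<bar>x + 1\<bar>) = k + 1 \<and> nat (int m - \<bar>x - 1\<bar>) = k - 1"
          using False k unfolding k_def by linarith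
        then have "comb_potential m (x + 1, 0) + comb_potential m (x - 1, 0) =
            spine_potential (k + 1) + spine_potential (k - 1)"
          unfolding pot0 by (metis add.commute)
        then show ?thesis
          using False spine_potential_recurrence[OF k]
          by (simp add: pot algebra_simps tip_weight_mult_comb_h)
      qed
      then have "4 * U (x, 0) = (if x = 0 then 1 else 0) + (U (x, 1) + U (x, -1) + U (x + 1, 0) + U (x - 1, 0))"
        using S by (simp add: U_def field_simps split: if_splits)
      then show ?thesis
        unfolding sumU[OF a] N using True by (simp add: xy add.assoc)
    qed
  qed
  have flux: "sum U {b \<in> I. comb_adj b z} = 1 / S * tip_weight (nat (int m - \<bar>fst z\<bar>))"
    if z: "z \<in> inner_boundary comb_adj (comb_ball m)" for z
  proof -
    obtain x y where xy: "z = (x, y)" by (cases z)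
    define k where "k = nat (int m - \<bar>x\<bar>)"
    have xm: "\<bar>x\<bar> \<le> int m" and yk: "\<bar>y\<bar> = comb_h k"
      using z by (auto simp: inner_boundary_comb_ball xy k_def)
    show ?thesis
    proof (cases "k = 0")
      case True
      then have x: "\<bar>x\<bar> = int m" and y: "y = 0" using xm yk by (auto simp: k_def)
      let ?b = "(x - sgn x, 0::int)"
      have *: "nat (int m - \<bar>x - sgn x\<bar>) = Suc 0"
        using x m by (auto simp: sgn_if)
      have "{b \<in> I. comb_adj b z} = {?b}"
      proof (intro set_eqI iffI)
        fix b assume b: "b \<in> {b \<in> I. comb_adj b z}"
        obtain x' y' where [simp]: "b = (x', y')" by (cases b)
        have "\<bar>x'\<bar> < int m" using b I_strict by auto
        with b show "b \<in> {?b}" using x by (auto simp: xy y sgn_if abs_if split: if_splits)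
      next
        fix b assume "b \<in> {?b}"
        then show "b \<in> {b \<in> I. comb_adj b z}"
          using x m * by (auto simp: I xy y sgn_if)
      qed
      then show ?thesis
        using * True by (simp add: U_def comb_potential_def tip_weight_def xy k_def)
    next
      case False
      then have h: "1 \<le> comb_h k" using comb_h_pos[of k] by simp
      let ?b = "(x, y - sgn y)"
      have "{b \<in> I. comb_adj b z} = {?b}"
      proof (intro set_eqI iffI)
        fix b assume b: "b \<in> {b \<in> I. comb_adj b z}"
        then show "b \<in> {?b}"
          using h yk by (cases b) (auto simp: xy I sgn_if abs_if k_def split: if_splits)
      next
        fix b assume "b \<in> {?b}"
        then show "b \<in> {b \<in> I. comb_adj b z}"
          using h yk xm by (auto simp: I xy sgn_if k_def)
      qed
      moreover have "comb_potential m ?b = tip_weight k"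
      proof -
        have "comb_h k - \<bar>y - sgn y\<bar> = 1"
          using h yk by (auto simp: sgn_if)
        then show ?thesis
          by (simp only: comb_potential_def prod.case k_def[symmetric] of_int_1 mult_1_right)
      qed
      ultimately show ?thesis
        by (simp add: U_def xy k_def[symmetric])
    qed
  qed
  have "harmonic_measure comb_adj (comb_ball m) (0, 0) z = sum U {b \<in> I. comb_adj b z}"
    if "z \<in> inner_boundary comb_adj (comb_ball m)" for z
    unfolding I_def
  proof (rule harmonic_measure_eq_potential_flux[OF finite_comb_ball _ _ _ _ that], fold I_def)
    show "(0, 0) \<in> I" using comb_h_pos[OF m] by (simp add: I)
    show "\<exists>b. comb_adj a b" for a by (rule exI[of _ "(fst a, snd a + 1)"], cases a) simp
    show "0 \<le> U a" if "a \<in> I" for a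
      using that S tip_weight_pos by (auto simp: U_def I comb_potential_def less_imp_le)
  qed (rule potential)
  then show ?thesis
    using S flux by (intro exI[of _ "1 / S"]) simp
qed

theorem theorem1p3:
  shows "\<exists>(e :: nat \<Rightarrow> real) c :: real.
    (\<forall>x. 0 < e x) \<and> 0 < c \<and> c < 1 / 2 \<and>
    (\<lambda>x. e x / real x) \<longlonglongrightarrow> c \<and>
    (\<forall>m. \<exists>C > 0. \<forall>z \<in> inner_boundary comb_adj (comb_ball m).
       harmonic_measure comb_adj (comb_ball m) (0, 0) z = C * e (nat (int m - \<bar>fst z\<bar>)))"
proof -
  obtain c where c: "0 < c" "c < 1 / 2" "(\<lambda>k. tip_weight k / real k) \<longlonglongrightarrow> c"
    using tip_weight_asymptotics by blast
  have "\<exists>C > 0. \<forall>z \<in> inner_boundary comb_adj (comb_ball m).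
       harmonic_measure comb_adj (comb_ball m) (0, 0) z = C * tip_weight (nat (int m - \<bar>fst z\<bar>))" for m
  proof (cases "m = 0")
    case True
    then show ?thesis
      using harmonic_measure_comb_ball_0
      by (intro exI[of _ 1]) (auto simp: tip_weight_def)
  next
    case False
    then show ?thesis using harmonic_measure_comb_ball[of m] by simp
  qed
  then show ?thesis using c tip_weight_pos by blast
qed

end
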